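(* Consider, for $M\in\mathbb{N}$, the difference initial value problem $$\sum_{k=0}^{m-1}d_{k}\,y_k+(d_{m}+p_m)\,y_m=f_m,\quad 1\le m\le M,\qquad y_0=\mu,$$ with bounded coefficients, where the coefficients $d_k=d_k^{(m)}$ ($0\le k\le m$) may depend on the equation index $m$. If for some $\delta>0$ (independent of $M$ and $m$) the coefficients satisfy $$|d_m+p_m|\ \ge\ \sum_{k=0}^{m-1}|d_k|+\delta\qquad\text{for all } m=1,\dots,M,$$ then the problem is well-conditioned, and its solution $\{y_m\}$ satisfies the upper estimate $$|y_m|\le\max\Bigl\{|\mu|,\ \frac1\delta\max_{k=0,1,\dots,m}|f_k|\Bigr\}.$$
   Context: The unknowns are $y_0,\dots,y_M$; the right-hand sides $\mu$ and $\{f_m\}$ are arbitrary real numbers ($f_0$, which does not enter the equations, is also an arbitrary real number, being $f(x_0)$ in the application). In the $m$-th equation, $d_k$ stands for $d_k^{(m)}$. "Bounded coefficients" means that there is a constant $P$, independent of $M$, with $|p_m|<P$ and $|d_k|<P$ for all $m$ and all $k=0,1,\dots,m$. Definition. The difference initial value problem with bounded coefficients is well-conditioned if for all large enough $M$ it has one and only one solution $\{y_m\}$ for arbitrary right-hand sides $\mu$ and $\{f_m\}$, and this solution satisfies $$|y_m|\le K\max\{|\mu|,\ \max_{m}|f_m|\},$$ where $K>0$ is a constant that does not depend on $M$. *)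

theory Defs
  imports Complex_Main "HOL-Library.FuncSet"
begin

(* Coefficients of the problem with a fixed M: d m k is d_k in the m-th equation.
   Only the values y 0, ..., y M and f 1, ..., f M matter. *)
definition ivp_solution ::
  "(nat \<Rightarrow> nat \<Rightarrow> real) \<Rightarrow> (nat \<Rightarrow> real) \<Rightarrow> nat \<Rightarrow> real \<Rightarrow> (nat \<Rightarrow> real) \<Rightarrow> (nat \<Rightarrow> real) \<Rightarrow> bool"
  where
  "ivp_solution d p M \<mu> f y \<longleftrightarrow>
     y 0 = \<mu> \<and> (\<forall>m\<in>{1..M}. (\<Sum>k=0..<m. d m k * y k) + (d m m + p m) * y m = f m)"

(* A whole family of problems, one for each M: the coefficients d M m k and p M m
   may depend on M, the bound may not. *)
definition bounded_coefficients ::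
  "(nat \<Rightarrow> nat \<Rightarrow> nat \<Rightarrow> real) \<Rightarrow> (nat \<Rightarrow> nat \<Rightarrow> real) \<Rightarrow> bool"
  where
  "bounded_coefficients d p \<longleftrightarrow>
     (\<exists>P. \<forall>M. \<forall>m\<in>{1..M}. \<bar>p M m\<bar> < P \<and> (\<forall>k\<in>{0..m}. \<bar>d M m k\<bar> < P))"

(* Uniqueness of the finite sequence y 0, ..., y M is uniqueness among functions that are
   undefined outside {0..M}.  The value f 0 enters no equation, so the maximum is over {1..M},
   which is nonempty for all large M. *)
definition well_conditioned ::
  "(nat \<Rightarrow> nat \<Rightarrow> nat \<Rightarrow> real) \<Rightarrow> (nat \<Rightarrow> nat \<Rightarrow> real) \<Rightarrow> bool"
  where
  "well_conditioned d p \<longleftrightarrow>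
     (\<exists>K>0. \<forall>\<^sub>F M in sequentially. \<forall>\<mu> f.
        (\<exists>!y. y \<in> {0..M} \<rightarrow>\<^sub>E UNIV \<and> ivp_solution (d M) (p M) M \<mu> f y) \<and>
        (\<forall>y. ivp_solution (d M) (p M) M \<mu> f y \<longrightarrow>
           (\<forall>m\<in>{0..M}. \<bar>y m\<bar> \<le> K * max \<bar>\<mu>\<bar> (MAX j\<in>{1..M}. \<bar>f j\<bar>))))"

end

theory Submission
  imports Defs
begin

text \<open>
  The system is lower triangular, and dominance makes each diagonal entry at least
  \<open>\<delta> > 0\<close> in absolute value, so forward substitution produces a solution. Everything else
  follows from one a priori bound: if \<open>B\<close> bounds \<open>\<bar>y k\<bar>\<close> for all \<open>k < m\<close> and
  \<open>\<bar>f m\<bar> \<le> \<delta> * B\<close>, then, with \<open>S\<close> the sum of the off-diagonal \<open>\<bar>d m k\<bar>\<close>, the \<open>m\<close>-th equation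
  gives \<open>\<bar>d m m + p m\<bar> * \<bar>y m\<bar> \<le> (S + \<delta>) * B \<le> \<bar>d m m + p m\<bar> * B\<close>, hence \<open>\<bar>y m\<bar> \<le> B\<close>
  (\<open>solution_bound\<close>).

  Three choices of \<open>B\<close> are made: \<open>B = 0\<close>, applied to the difference of two solutions, gives
  uniqueness; \<open>B = max 1 (1/\<delta>) * max \<bar>\<mu>\<bar> (MAX j. \<bar>f j\<bar>)\<close> gives a stability constant independent
  of the number of equations; and \<open>B = max \<bar>\<mu>\<bar> (1/\<delta> * (MAX k. \<bar>f k\<bar>))\<close> gives the sharper estimate.
\<close>

lemma solution_exists:
  assumes "\<And>m. m \<in> {1..M} \<Longrightarrow> d m m + p m \<noteq> 0"
  shows "\<exists>y. ivp_solution d p M \<mu> f y"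
  using assms
proof (induction M)
  case 0
  show ?case by (intro exI[of _ "\<lambda>_. \<mu>"]) (simp add: ivp_solution_def)
next
  case (Suc M)
  then obtain y where y: "ivp_solution d p M \<mu> f y" by fastforce
  define c where "c = (f (Suc M) - (\<Sum>k=0..<Suc M. d (Suc M) k * y k)) / (d (Suc M) (Suc M) + p (Suc M))"
  define z where "z = y(Suc M := c)"
  have earlier_terms: "(\<Sum>k=0..<m. d m k * z k) = (\<Sum>k=0..<m. d m k * y k)" if "m \<le> Suc M" for m
    using that by (intro sum.cong) (auto simp: z_def)
  have "(\<Sum>k=0..<m. d m k * z k) + (d m m + p m) * z m = f m" if m: "m \<in> {1..Suc M}" for m
  proof (cases "m = Suc M")
    case True
    have "d (Suc M) (Suc M) + p (Suc M) \<noteq> 0"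
      by (rule Suc.prems) simp
    then have "(d (Suc M) (Suc M) + p (Suc M)) * c = f (Suc M) - (\<Sum>k=0..<Suc M. d (Suc M) k * y k)"
      unfolding c_def by (metis nonzero_mult_div_cancel_left times_divide_eq_right)
    then show ?thesis
      using earlier_terms[of "Suc M"] True by (simp add: z_def)
  next
    case False
    then show ?thesis
      using y m earlier_terms[of m] by (simp add: ivp_solution_def z_def)
  qed
  moreover have "z 0 = \<mu>"
    using y by (simp add: z_def ivp_solution_def)
  ultimately show ?case
    unfolding ivp_solution_def by blast
qed

lemma ivp_solution_cong:
  assumes "\<And>k. k \<le> M \<Longrightarrow> y k = z k"
  shows "ivp_solution d p M \<mu> f y \<longleftrightarrow> ivp_solution d p M \<mu> f z"
proof -
  have "(\<Sum>k=0..<m. d m k * y k) = (\<Sum>k=0..<m. d m k * z k)" if "m \<in> {1..M}" for m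
    using that assms by (intro sum.cong) auto
  then show ?thesis
    using assms by (simp add: ivp_solution_def)
qed

lemma ivp_solution_diff:
  assumes "ivp_solution d p M \<mu> f y" and "ivp_solution d p M \<nu> g z"
  shows "ivp_solution d p M (\<mu> - \<nu>) (\<lambda>k. f k - g k) (\<lambda>k. y k - z k)"
proof -
  have "(\<Sum>k=0..<m. d m k * (y k - z k)) + (d m m + p m) * (y m - z m) = f m - g m"
    if "m \<in> {1..M}" for m
  proof -
    have "(\<Sum>k=0..<m. d m k * y k) + (d m m + p m) * y m = f m"
      "(\<Sum>k=0..<m. d m k * z k) + (d m m + p m) * z m = g m"
      using assms that by (auto simp: ivp_solution_def)
    then show ?thesis
      by (simp add: right_diff_distrib sum_subtractf)
  qed
  then show ?thesis
    using assms by (simp add: ivp_solution_def)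
qed

text \<open>
  Leaving \<open>B\<close> abstract, and asking for control of \<open>f\<close> only up to index \<open>m\<close>, is what lets the same
  induction serve uniqueness, stability and the estimate by the data up to index \<open>m\<close>.
\<close>

lemma solution_bound:
  fixes d :: "nat \<Rightarrow> nat \<Rightarrow> real"
  assumes "\<delta> > 0"
    and dominance: "\<And>m. m \<in> {1..M} \<Longrightarrow> \<bar>d m m + p m\<bar> \<ge> (\<Sum>k=0..<m. \<bar>d m k\<bar>) + \<delta>"
    and solution: "ivp_solution d p M \<mu> f y"
    and initial: "\<bar>\<mu>\<bar> \<le> B"
    and "m \<le> M" and "\<And>k. k \<in> {1..m} \<Longrightarrow> \<bar>f k\<bar> \<le> \<delta> * B"
  shows "\<bar>y m\<bar> \<le> B"
  using assms(5,6)
proof (induction m rule: less_induct)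
  case (less m)
  show ?case
  proof (cases "m = 0")
    case True
    then show ?thesis using solution initial by (simp add: ivp_solution_def)
  next
    case False
    then have m: "m \<in> {1..M}" using less.prems by simp
    let ?D = "d m m + p m" and ?S = "\<Sum>k=0..<m. \<bar>d m k\<bar>"
    have "B \<ge> 0" using initial by linarith
    have "\<bar>\<Sum>k=0..<m. d m k * y k\<bar> \<le> (\<Sum>k=0..<m. \<bar>d m k * y k\<bar>)"
      by (rule sum_abs)
    also have "\<dots> \<le> (\<Sum>k=0..<m. \<bar>d m k\<bar> * B)"
      using less by (intro sum_mono) (auto simp: abs_mult intro!: mult_left_mono)
    finally have off_diagonal: "\<bar>\<Sum>k=0..<m. d m k * y k\<bar> \<le> ?S * B"
      by (simp add: sum_distrib_right)
    have "(\<Sum>k=0..<m. d m k * y k) + ?D * y m = f m"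
      using solution m by (simp add: ivp_solution_def)
    moreover have "\<bar>f m\<bar> \<le> \<delta> * B"
      using less.prems m by simp
    ultimately have "\<bar>?D * y m\<bar> \<le> ?S * B + \<delta> * B"
      using off_diagonal by linarith
    also have "\<dots> = (?S + \<delta>) * B"
      by (simp add: distrib_right)
    also have "\<dots> \<le> \<bar>?D\<bar> * B"
      using dominance[OF m] \<open>B \<ge> 0\<close> by (rule mult_right_mono)
    finally have "\<bar>?D\<bar> * \<bar>y m\<bar> \<le> \<bar>?D\<bar> * B"
      by (simp add: abs_mult)
    moreover have "\<bar>?D\<bar> > 0"
    proof -
      have "?S \<ge> 0" by (intro sum_nonneg) simp
      then show ?thesis using dominance[OF m] \<open>\<delta> > 0\<close> by linarith
    qed
    ultimately show ?thesis
      by (simp only: mult_le_cancel_left_pos)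
  qed
qed

lemma solution_exists_unique:
  fixes d :: "nat \<Rightarrow> nat \<Rightarrow> real"
  assumes "\<delta> > 0"
    and dominance: "\<And>m. m \<in> {1..M} \<Longrightarrow> \<bar>d m m + p m\<bar> \<ge> (\<Sum>k=0..<m. \<bar>d m k\<bar>) + \<delta>"
  shows "\<exists>!y. y \<in> {0..M} \<rightarrow>\<^sub>E UNIV \<and> ivp_solution d p M \<mu> f y"
proof (rule ex_ex1I)
  have "d m m + p m \<noteq> 0" if "m \<in> {1..M}" for m
  proof -
    have "(\<Sum>k=0..<m. \<bar>d m k\<bar>) \<ge> 0" by (intro sum_nonneg) simp
    then show ?thesis using dominance[OF that] \<open>\<delta> > 0\<close> by linarith
  qed
  then obtain y where "ivp_solution d p M \<mu> f y"
    using solution_exists by blast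
  then have "ivp_solution d p M \<mu> f (restrict y {0..M})"
    using ivp_solution_cong[of M y "restrict y {0..M}"] by simp
  then show "\<exists>y. y \<in> {0..M} \<rightarrow>\<^sub>E UNIV \<and> ivp_solution d p M \<mu> f y"
    by (intro exI[of _ "restrict y {0..M}"]) simp
next
  fix y z
  assume y: "y \<in> {0..M} \<rightarrow>\<^sub>E UNIV \<and> ivp_solution d p M \<mu> f y"
    and z: "z \<in> {0..M} \<rightarrow>\<^sub>E UNIV \<and> ivp_solution d p M \<mu> f z"
  have homogeneous: "ivp_solution d p M 0 (\<lambda>_. 0) (\<lambda>k. y k - z k)"
    using ivp_solution_diff[of d p M \<mu> f y \<mu> f z] y z by simp
  have "y k = z k" if "k \<in> {0..M}" for k
    using solution_bound[OF assms homogeneous, of 0 k] that by simp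
  then show "y = z"
    using y z by (auto intro: PiE_ext)
qed

theorem theorem3:
  fixes d :: "nat \<Rightarrow> nat \<Rightarrow> nat \<Rightarrow> real" and p :: "nat \<Rightarrow> nat \<Rightarrow> real" and \<delta> :: real
  assumes bounded: "bounded_coefficients d p"
    and "\<delta> > 0"
    and dominance: "\<And>M m. m \<in> {1..M} \<Longrightarrow>
           \<bar>d M m m + p M m\<bar> \<ge> (\<Sum>k=0..<m. \<bar>d M m k\<bar>) + \<delta>"
  shows "well_conditioned d p \<and>
         (\<forall>M \<mu> f y. ivp_solution (d M) (p M) M \<mu> f y \<longrightarrow>
            (\<forall>m\<in>{0..M}. \<bar>y m\<bar> \<le> max \<bar>\<mu>\<bar> (1 / \<delta> * (MAX k\<in>{0..m}. \<bar>f k\<bar>))))"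
proof (intro conjI allI impI ballI)
  define K where "K = max 1 (1 / \<delta>)"
  have K: "K \<ge> 1" "\<delta> * K \<ge> 1"
    using \<open>\<delta> > 0\<close> by (auto simp: K_def max_def field_simps)
  have stable: "\<bar>y m\<bar> \<le> K * max \<bar>\<mu>\<bar> (MAX j\<in>{1..M}. \<bar>f j\<bar>)"
    if solution: "ivp_solution (d M) (p M) M \<mu> f y" and m: "m \<in> {0..M}" for M \<mu> f y m
  proof -
    let ?R = "max \<bar>\<mu>\<bar> (MAX j\<in>{1..M}. \<bar>f j\<bar>)"
    have "0 \<le> ?R" by (simp add: le_max_iff_disj)
    have "?R \<le> K * ?R" "?R \<le> \<delta> * K * ?R"
      using mult_right_mono[OF K(1) \<open>0 \<le> ?R\<close>] mult_right_mono[OF K(2) \<open>0 \<le> ?R\<close>]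
      by (simp_all only: mult_1_left)
    moreover have "\<bar>f k\<bar> \<le> ?R" if "k \<in> {1..m}" for k
      using that m by (intro max.coboundedI2 Max_ge) auto
    moreover have "\<bar>\<mu>\<bar> \<le> ?R" by simp
    ultimately show ?thesis
      using m by (intro solution_bound[OF \<open>\<delta> > 0\<close> dominance solution])
        (auto simp only: mult.assoc atLeastAtMost_iff intro: order_trans)
  qed
  have "K > 0" using K(1) by linarith
  moreover have "\<exists>!y. y \<in> {0..M} \<rightarrow>\<^sub>E UNIV \<and> ivp_solution (d M) (p M) M \<mu> f y" for M \<mu> f
    using \<open>\<delta> > 0\<close> dominance by (rule solution_exists_unique)
  ultimately show "well_conditioned d p"
    unfolding well_conditioned_def using stable
    by (intro exI[of _ K] conjI always_eventually allI impI ballI) assumption+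
next
  fix M \<mu> f y m
  assume solution: "ivp_solution (d M) (p M) M \<mu> f y" and m: "m \<in> {0..M}"
  let ?F = "MAX k\<in>{0..m}. \<bar>f k\<bar>"
  have "\<bar>f k\<bar> \<le> \<delta> * max \<bar>\<mu>\<bar> (1 / \<delta> * ?F)" if "k \<in> {1..m}" for k
  proof -
    have "\<bar>f k\<bar> \<le> ?F"
      using that by (intro Max_ge) auto
    also have "\<dots> = \<delta> * (1 / \<delta> * ?F)"
      using \<open>\<delta> > 0\<close> by simp
    also have "\<dots> \<le> \<delta> * max \<bar>\<mu>\<bar> (1 / \<delta> * ?F)"
      using \<open>\<delta> > 0\<close> by (intro mult_left_mono) auto
    finally show ?thesis .
  qed
  then show "\<bar>y m\<bar> \<le> max \<bar>\<mu>\<bar> (1 / \<delta> * ?F)"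
    using m by (intro solution_bound[OF \<open>\<delta> > 0\<close> dominance solution]) auto
qed

end
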